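(* Let $\mathcal{K}$ be a finite oriented simplicial complex of dimension $K$ with positive weights $w:\mathcal{K}\to(0,\infty)$. For $0\le k\le K$ let $L_k=L_k^{\mathrm{u}}+L_k^{\mathrm{d}}$ be the $k$-th weighted Hodge Laplacian, where $L_k^{\mathrm{d}}=B_k^TW_{k-1}^{-1}B_kW_k$ is the weighted down Laplacian and $L_k^{\mathrm{u}}=W_k^{-1}B_{k+1}W_{k+1}B_{k+1}^T$ is the weighted up Laplacian. Then the Laplacian matrices $L_k$ and the associated up and down Laplacians $L_k^{\mathrm{u}}$, $L_k^{\mathrm{d}}$ satisfy: (1) The eigenvectors of the nonzero eigenvalues of $L_k^{\mathrm{d}}$ are orthogonal, with respect to the inner product $(f,g)_{C^k}=g^TW_kf$, to the eigenvectors of the nonzero eigenvalues of $L_k^{\mathrm{u}}$, and vice versa. (2) If $v$ is an eigenvector of $L_{k-1}^{\mathrm{u}}$ (where $k\ge 1$), then $B_k^Tv$ is an eigenvector of $L_k^{\mathrm{d}}$ with the same eigenvalue. (3) The eigenvectors associated with the nonzero eigenvalues $\lambda$ of $L_k$ are either eigenvectors of $L_k^{\mathrm{d}}$ or eigenvectors of $L_k^{\mathrm{u}}$; that is, every eigenvector of $L_k$ with nonzero eigenvalue is an eigenvector of $L_k^{\mathrm{d}}$ or of $L_k^{\mathrm{u}}$. (4) The nonzero eigenvalues of $L_k$ are either eigenvalues of $L_k^{\mathrm{d}}$ or eigenvalues of $L_k^{\mathrm{u}}$.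
   Context: A (finite abstract) simplicial complex $\mathcal{K}$ is a finite collection of finite nonempty vertex sets closed under taking nonempty subsets; a $k$-simplex is an element with $k+1$ vertices, and the dimension $K$ is the largest order $k$ of a simplex. Each simplex carries a fixed orientation (an ordering of its vertices up to even permutation; vertices have the trivial orientation). $D_k$ is the number of $k$-simplices, and $C_k(\mathcal{K},\mathbb{R})\cong\mathbb{R}^{D_k}$ is the space of real linear combinations of oriented $k$-simplices. For $1\le k\le K$, the incidence matrix $B_k\in\mathbb{R}^{D_{k-1}\times D_k}$ is the matrix of the unweighted boundary operator $[v_{i_0},\dots,v_{i_k}]\mapsto\sum_{j=0}^k(-1)^j[v_{i_0},\dots,v_{i_k}]\setminus[v_{i_j}]$ in the bases of oriented simplices: its $(i,j)$ entry is $0$ if the $(k-1)$-simplex $\sigma_i^{k-1}$ is not a face of $\sigma_j^k$, and otherwise $1$ or $-1$ according to whether the orientations of $\sigma_i^{k-1}$ and $\sigma_j^k$ are coherent or not. One has $B_kB_{k+1}=0$. $W_k\in\mathbb{R}^{D_k\times D_k}$ is the diagonal matrix of the (positive) weights of the $k$-simplices. Conventions: the terms involving $B_0$ and $B_{K+1}$ vanish, so $L_0^{\mathrm{d}}=0$ and $L_K^{\mathrm{u}}=0$.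
   Formalization: In (2), B_k^T v is claimed to be an eigenvector only for nonzero eigenvalues (for 0 it vanishes). In (3), the eigenvalue must not be shared by L_k^d and L_k^u (false otherwise, e.g. full triangle, k=1); in general v is an eigenvector of L_k^d or of L_k^u, or a sum of one of each. *)

theory Defs
  imports
    "Jordan_Normal_Form.Char_Poly"
    "HOL-Combinatorics.Permutations"
begin

definition simplicial_complex :: "'a set set \<Rightarrow> bool" where
  "simplicial_complex X \<longleftrightarrow>
     finite X \<and>
     (\<forall>\<sigma>\<in>X. finite \<sigma> \<and> \<sigma> \<noteq> {}) \<and>
     (\<forall>\<sigma>\<in>X. \<forall>\<tau>. \<tau> \<noteq> {} \<and> \<tau> \<subseteq> \<sigma> \<longrightarrow> \<tau> \<in> X)"

definition simplices :: "'a set set \<Rightarrow> nat \<Rightarrow> 'a set set" where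
  "simplices X k = {\<sigma> \<in> X. card \<sigma> = k + 1}"

definition num_simplices :: "'a set set \<Rightarrow> nat \<Rightarrow> nat" where
  "num_simplices X k = card (simplices X k)"

text \<open>Meaningful only for a nonempty complex.\<close>

definition complex_dim :: "'a set set \<Rightarrow> nat" where
  "complex_dim X = Max ((\<lambda>\<sigma>. card \<sigma> - 1) ` X)"

text \<open>The orientation of a simplex is given by a representative ordering of its vertices.
  The matrices below depend on this ordering only up to even permutations.\<close>

definition orientation :: "'a set set \<Rightarrow> ('a set \<Rightarrow> 'a list) \<Rightarrow> bool" where
  "orientation X ori \<longleftrightarrow> (\<forall>\<sigma>\<in>X. distinct (ori \<sigma>) \<and> set (ori \<sigma>) = \<sigma>)"

text \<open>An enumeration of the simplices of each order; it identifies the space of real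
  \<open>k\<close>-chains with the vectors of length \<open>num_simplices X k\<close>.\<close>

definition enumeration :: "'a set set \<Rightarrow> (nat \<Rightarrow> nat \<Rightarrow> 'a set) \<Rightarrow> bool" where
  "enumeration X enum \<longleftrightarrow> (\<forall>k. bij_betw (enum k) {..<num_simplices X k} (simplices X k))"

definition same_orientation :: "'a list \<Rightarrow> 'a list \<Rightarrow> bool" where
  "same_orientation xs ys \<longleftrightarrow> (\<exists>p. p permutes set xs \<and> evenperm p \<and> map p xs = ys)"

text \<open>The coefficient of the oriented simplex \<open>[xs]\<close> with respect to the basis element \<open>[ys]\<close>,
  for lists of distinct vertices: orderings differing by an odd permutation represent
  opposite chains.\<close>

definition simplex_coeff :: "'a list \<Rightarrow> 'a list \<Rightarrow> real" where
  "simplex_coeff ys xs =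
     (if set xs \<noteq> set ys then 0 else if same_orientation xs ys then 1 else - 1)"

text \<open>The coefficient of \<open>[ys]\<close> in the boundary of \<open>[xs]\<close>. At most one summand is nonzero, so
  this is \<open>0\<close> unless \<open>ys\<close> spans a facet of \<open>xs\<close>, and otherwise \<open>1\<close> or \<open>-1\<close> according to whether the
  orientations are coherent.\<close>

definition boundary_coeff :: "'a list \<Rightarrow> 'a list \<Rightarrow> real" where
  "boundary_coeff ys xs =
     (\<Sum>j<length xs. (- 1) ^ j * simplex_coeff ys (take j xs @ drop (Suc j) xs))"

text \<open>Used only for \<open>k \<ge> 1\<close>. For \<open>k\<close> one above the dimension it has no columns.\<close>

definition incidence_mat ::
    "'a set set \<Rightarrow> ('a set \<Rightarrow> 'a list) \<Rightarrow> (nat \<Rightarrow> nat \<Rightarrow> 'a set) \<Rightarrow> nat \<Rightarrow> real mat" where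
  "incidence_mat X ori enum k =
     mat (num_simplices X (k - 1)) (num_simplices X k)
       (\<lambda>(i, j). boundary_coeff (ori (enum (k - 1) i)) (ori (enum k j)))"

definition weight_mat ::
    "'a set set \<Rightarrow> (nat \<Rightarrow> nat \<Rightarrow> 'a set) \<Rightarrow> ('a set \<Rightarrow> real) \<Rightarrow> nat \<Rightarrow> real mat" where
  "weight_mat X enum w k = mat_diag (num_simplices X k) (\<lambda>i. w (enum k i))"

definition weight_mat_inv ::
    "'a set set \<Rightarrow> (nat \<Rightarrow> nat \<Rightarrow> 'a set) \<Rightarrow> ('a set \<Rightarrow> real) \<Rightarrow> nat \<Rightarrow> real mat" where
  "weight_mat_inv X enum w k = mat_diag (num_simplices X k) (\<lambda>i. inverse (w (enum k i)))"

definition weight_inner ::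
    "'a set set \<Rightarrow> (nat \<Rightarrow> nat \<Rightarrow> 'a set) \<Rightarrow> ('a set \<Rightarrow> real) \<Rightarrow> nat
      \<Rightarrow> real vec \<Rightarrow> real vec \<Rightarrow> real" where
  "weight_inner X enum w k f g = g \<bullet> (weight_mat X enum w k *\<^sub>v f)"

definition down_laplacian ::
    "'a set set \<Rightarrow> ('a set \<Rightarrow> 'a list) \<Rightarrow> (nat \<Rightarrow> nat \<Rightarrow> 'a set) \<Rightarrow> ('a set \<Rightarrow> real)
      \<Rightarrow> nat \<Rightarrow> real mat" where
  "down_laplacian X ori enum w k =
     (if k = 0 then 0\<^sub>m (num_simplices X 0) (num_simplices X 0)
      else transpose_mat (incidence_mat X ori enum k) * weight_mat_inv X enum w (k - 1)
             * incidence_mat X ori enum k * weight_mat X enum w k)"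

definition up_laplacian ::
    "'a set set \<Rightarrow> ('a set \<Rightarrow> 'a list) \<Rightarrow> (nat \<Rightarrow> nat \<Rightarrow> 'a set) \<Rightarrow> ('a set \<Rightarrow> real)
      \<Rightarrow> nat \<Rightarrow> real mat" where
  "up_laplacian X ori enum w k =
     weight_mat_inv X enum w k * incidence_mat X ori enum (k + 1)
       * weight_mat X enum w (k + 1) * transpose_mat (incidence_mat X ori enum (k + 1))"

definition hodge_laplacian ::
    "'a set set \<Rightarrow> ('a set \<Rightarrow> 'a list) \<Rightarrow> (nat \<Rightarrow> nat \<Rightarrow> 'a set) \<Rightarrow> ('a set \<Rightarrow> real)
      \<Rightarrow> nat \<Rightarrow> real mat" where
  "hodge_laplacian X ori enum w k =
     up_laplacian X ori enum w k + down_laplacian X ori enum w k"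

lemma weight_mat_inverse:
  assumes "enumeration X enum" and "\<And>\<sigma>. \<sigma> \<in> X \<Longrightarrow> 0 < w \<sigma>"
  shows "weight_mat X enum w k * weight_mat_inv X enum w k = 1\<^sub>m (num_simplices X k)"
    and "weight_mat_inv X enum w k * weight_mat X enum w k = 1\<^sub>m (num_simplices X k)"
proof -
  have "w (enum k i) \<noteq> 0" if "i < num_simplices X k" for i
  proof -
    have "enum k i \<in> X"
      using assms(1) that unfolding enumeration_def bij_betw_def simplices_def by blast
    then show ?thesis using assms(2) by fastforce
  qed
  then show "weight_mat X enum w k * weight_mat_inv X enum w k = 1\<^sub>m (num_simplices X k)"
    and "weight_mat_inv X enum w k * weight_mat X enum w k = 1\<^sub>m (num_simplices X k)"
    unfolding weight_mat_def weight_mat_inv_def mat_diag_diag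
    by (auto simp: mat_diag_def intro!: eq_matI)
qed

text \<open>The convention that the up Laplacian vanishes in the top dimension is automatic.\<close>

lemma up_laplacian_top:
  assumes "finite X"
  shows "up_laplacian X ori enum w (complex_dim X) =
    0\<^sub>m (num_simplices X (complex_dim X)) (num_simplices X (complex_dim X))"
proof -
  have "simplices X (complex_dim X + 1) = {}"
  proof (rule equals0I)
    fix \<sigma> assume "\<sigma> \<in> simplices X (complex_dim X + 1)"
    then have "\<sigma> \<in> X" and c: "card \<sigma> = complex_dim X + 2" by (auto simp: simplices_def)
    have "card \<sigma> - 1 \<in> (\<lambda>\<sigma>. card \<sigma> - 1) ` X"
      using \<open>\<sigma> \<in> X\<close> by (rule imageI)
    then have "card \<sigma> - 1 \<le> complex_dim X"
      using assms unfolding complex_dim_def by (intro Max_ge) simp_all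
    with c show False by simp
  qed
  then have "num_simplices X (Suc (complex_dim X)) = 0" by (simp add: num_simplices_def)
  then show ?thesis
    unfolding up_laplacian_def incidence_mat_def weight_mat_def weight_mat_inv_def mat_diag_def
    by (intro eq_matI) (auto simp: scalar_prod_def)
qed

end

theory Submission
  imports Defs
begin

text \<open>The coefficient of \<open>[zs]\<close> in the boundary of \<open>[ys]\<close> is the sign of the permutation relating
  \<open>ys\<close> to \<open>v # zs\<close>, where \<open>v\<close> is the vertex missing from \<open>zs\<close>. Hence the boundary does not depend
  on the representatives of the intermediate simplices, and \<open>B\<^sub>k B\<^sub>k\<^sub>+\<^sub>1 = 0\<close> reduces to the
  cancellation in pairs of the terms of a double vertex deletion. It follows that the up and the down
  Laplacian annihilate each other. An eigenvector \<open>v\<close> of their sum for \<open>a \<noteq> 0\<close> is thus the sum of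
  \<open>a\<^sup>-\<^sup>1 L\<^sup>d v\<close> and \<open>a\<^sup>-\<^sup>1 L\<^sup>u v\<close>, each of which is zero or an eigenvector for \<open>a\<close>, and orthogonality
  holds because \<open>W L\<^sup>d\<close> is symmetric.\<close>

section \<open>Orientation signs\<close>

lemma obtain_permutation_of_lists:
  assumes "distinct xs" "distinct ys" "set xs = set ys"
  obtains p where "p permutes set xs" "map p xs = ys"
proof -
  have len: "length xs = length ys"
    using assms by (metis distinct_card)
  \<comment> \<open>Each entry of \<open>xs\<close> goes to the entry of \<open>ys\<close> at the
    same position; all other points are fixed, as \<open>permutes\<close> demands.\<close>
  define p where "p = (\<lambda>x. case map_of (zip xs ys) x of None \<Rightarrow> x | Some y \<Rightarrow> y)"
  have map: "map p xs = ys"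
    using len assms by (intro nth_equalityI) (auto simp: p_def map_of_zip_nth)
  have "p permutes set xs"
  proof (rule bij_imp_permutes)
    have "inj_on p (set xs)" using map assms by (metis distinct_map)
    moreover have "p ` set xs = set xs" using map assms by (metis set_map)
    ultimately show "bij_betw p (set xs) (set xs)" by (simp add: bij_betw_def)
    show "p x = x" if "x \<notin> set xs" for x
      using that len by (simp add: p_def map_of_zip_is_None[THEN iffD2])
  qed
  with map show ?thesis by (rule that[rotated])
qed

lemma permutes_map_eq_imp_eq:
  assumes "p permutes set xs" "q permutes set xs" "map p xs = map q xs"
  shows "p = q"
proof
  fix x show "p x = q x"
    using assms by (cases "x \<in> set xs") (auto simp: permutes_not_in)
qed

text \<open>A permutation of the vertices is determined by the list it produces, so the existential
  in \<open>same_orientation\<close> has \<open>p\<close> as its only candidate and reduces to the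
  parity of \<open>p\<close>.\<close>

lemma simplex_coeff_map:
  assumes "p permutes set xs"
  shows "simplex_coeff (map p xs) xs = of_int (sign p)"
proof -
  have "same_orientation xs (map p xs) \<longleftrightarrow> evenperm p"
    unfolding same_orientation_def using assms permutes_map_eq_imp_eq by blast
  moreover have "set (map p xs) = set xs"
    using assms by (simp add: permutes_image)
  ultimately show ?thesis by (simp add: simplex_coeff_def sign_def)
qed

text \<open>Multiplicativity of the sign under composition. If \<open>zs\<close> spans a different
  vertex set, both sides vanish.\<close>

lemma simplex_coeff_trans:
  assumes "distinct xs" "distinct ys" "distinct zs" "set xs = set ys"
  shows "simplex_coeff zs ys * simplex_coeff ys xs = simplex_coeff zs xs"
proof (cases "set zs = set ys")
  case True
  obtain p where p: "p permutes set xs" "map p xs = ys"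
    using obtain_permutation_of_lists assms by metis
  obtain q where q: "q permutes set ys" "map q ys = zs"
    using obtain_permutation_of_lists assms True by metis
  have q': "q permutes set xs" using q assms by simp
  have "zs = map (q \<circ> p) xs" using p q by auto
  then have "simplex_coeff zs xs = of_int (sign (q \<circ> p))"
    using simplex_coeff_map permutes_compose[OF p(1) q'] by metis
  also have "\<dots> = of_int (sign q) * of_int (sign p)"
    using p q by (simp add: sign_compose permutes_imp_permutation[OF finite_set])
  finally show ?thesis using p q simplex_coeff_map by metis
next
  case False
  then show ?thesis using assms by (auto simp: simplex_coeff_def)
qed

text \<open>A permutation of \<open>set xs\<close> fixes the new vertex \<open>a\<close>, so it also
  relates the longer lists, with the same sign.\<close>

lemma simplex_coeff_Cons:
  assumes "distinct (a # xs)" "distinct (a # ys)"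
  shows "simplex_coeff (a # ys) (a # xs) = simplex_coeff ys xs"
proof (cases "set xs = set ys")
  case True
  obtain p where p: "p permutes set xs" "map p xs = ys"
    using obtain_permutation_of_lists True assms by (metis distinct.simps(2))
  have "p permutes set (a # xs)"
    using p permutes_imp_permutes_insert by simp
  moreover have "map p (a # xs) = a # ys"
    using p assms by (simp add: permutes_not_in)
  ultimately show ?thesis using p simplex_coeff_map by metis
next
  case False
  then have "set (a # xs) \<noteq> set (a # ys)"
    using assms by (metis distinct.simps(2) insert_ident list.simps(15))
  with False show ?thesis by (simp only: simplex_coeff_def not_False_eq_True if_True)
qed

lemma simplex_coeff_swap:
  assumes "distinct (a # b # xs)"
  shows "simplex_coeff (b # a # xs) (a # b # xs) = - 1"
proof -
  have "map (Transposition.transpose a b) (a # b # xs) = b # a # xs"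
    using assms by (auto simp: transpose_def intro!: map_idI)
  moreover have "Transposition.transpose a b permutes set (a # b # xs)"
    by (rule permutes_swap_id) auto
  ultimately show ?thesis
    using simplex_coeff_map[of "Transposition.transpose a b" "a # b # xs"] assms
    by (auto simp: sign_swap_id)
qed

lemma simplex_coeff_move_to_front:
  assumes "distinct (xs @ v # ys)"
  shows "simplex_coeff (v # xs @ ys) (xs @ v # ys) = (- 1) ^ length xs"
  using assms
proof (induction xs)
  case Nil
  have "id permutes set (v # ys)" by (rule permutes_id)
  from simplex_coeff_map[OF this] show ?case by simp
next
  case (Cons a xs)
  \<comment> \<open>Pass through the ordering that has \<open>v\<close> in second place: the last
    swap costs -1, and the rest is the induction hypothesis behind the common head
    \<open>a\<close>.\<close>
  have "simplex_coeff (v # a # xs @ ys) (a # xs @ v # ys) =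
      simplex_coeff (v # a # xs @ ys) (a # v # xs @ ys)
        * simplex_coeff (a # v # xs @ ys) (a # xs @ v # ys)"
    using Cons.prems by (intro simplex_coeff_trans[symmetric]) auto
  also have "simplex_coeff (v # a # xs @ ys) (a # v # xs @ ys) = - 1"
    using Cons.prems by (intro simplex_coeff_swap) auto
  also have "simplex_coeff (a # v # xs @ ys) (a # xs @ v # ys)
      = simplex_coeff (v # xs @ ys) (xs @ v # ys)"
    using Cons.prems by (intro simplex_coeff_Cons) auto
  finally show ?case using Cons by simp
qed

section \<open>The boundary of a boundary\<close>

definition delete_nth :: "nat \<Rightarrow> 'a list \<Rightarrow> 'a list" where
  "delete_nth j xs = take j xs @ drop (Suc j) xs"

lemma length_delete_nth: "j < length xs \<Longrightarrow> length (delete_nth j xs) = length xs - 1"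
  by (simp add: delete_nth_def)

lemma nth_delete_nth:
  assumes "j < length xs" "i < length xs - 1"
  shows "delete_nth j xs ! i = xs ! (if i < j then i else Suc i)"
  using assms by (auto simp: delete_nth_def nth_append min_def)

text \<open>The simplicial identity: once position \<open>j\<close> is gone, position
  \<open>i\<close> with \<open>j \<le> i\<close> holds what was at \<open>Suc i\<close>.\<close>

lemma delete_nth_delete_nth:
  assumes "j \<le> i" "Suc i < length xs"
  shows "delete_nth i (delete_nth j xs) = delete_nth j (delete_nth (Suc i) xs)"
  using assms by (intro nth_equalityI) (auto simp: length_delete_nth nth_delete_nth)

lemma distinct_delete_nth: "distinct xs \<Longrightarrow> distinct (delete_nth j xs)"
  by (auto simp: delete_nth_def set_take_disj_set_drop_if_distinct)

lemma set_delete_nth: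
  assumes "distinct xs" "j < length xs"
  shows "set (delete_nth j xs) = set xs - {xs ! j}"
proof -
  have "xs = take j xs @ xs ! j # drop (Suc j) xs"
    using assms by (simp add: id_take_nth_drop)
  then obtain us vs where xs: "xs = us @ xs ! j # vs" "length us = j"
    using assms by (metis length_take min.absorb4)
  define v where "v = xs ! j"
  have "xs = us @ v # vs" using xs v_def by simp
  then show ?thesis using assms(1) xs(2) unfolding v_def[symmetric]
    by (auto simp: delete_nth_def)
qed

text \<open>By the simplicial identity every face with two vertices removed arises from two orders
  of deletion, whose signs are opposite because the index sums differ by one.\<close>

lemma sum_delete_nth_twice:
  fixes g :: "'a list \<Rightarrow> real"
  shows "(\<Sum>j<length xs. \<Sum>i<length xs - 1. (- 1) ^ (i + j) * g (delete_nth i (delete_nth j xs))) = 0"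
proof -
  define n where "n = length xs"
  define h where "h = (\<lambda>(j, i). (- 1) ^ (i + j) * g (delete_nth i (delete_nth j xs)))"
  define P where "P = {..<n} \<times> {..<n - 1}"
  define A where "A = {(j, i). (j, i) \<in> P \<and> j \<le> i}"
  define C where "C = {(j, i). (j, i) \<in> P \<and> i < j}"
  have fin: "finite P" by (simp add: P_def)
  have "(\<Sum>j<n. \<Sum>i<n - 1. (- 1) ^ (i + j) * g (delete_nth i (delete_nth j xs))) = sum h P"
    by (simp add: P_def h_def sum.cartesian_product)
  also have "P = A \<union> C" by (auto simp: A_def C_def)
  also have "sum h (A \<union> C) = sum h A + sum h C"
    using fin by (intro sum.union_disjoint)
      (auto simp: A_def C_def intro: finite_subset[of _ P])
  \<comment> \<open>In a pair, \<open>j\<close> is the first deletion and \<open>i\<close> the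
    second; \<open>(j, i)\<close> in \<open>A\<close> is matched with \<open>(Suc i, j)\<close> in
    \<open>C\<close>.\<close>
  also have "sum h A = sum (\<lambda>x. - h x) C"
    by (rule sum.reindex_bij_witness
        [where i = "\<lambda>(j, i). (i, j - 1)" and j = "\<lambda>(j, i). (Suc i, j)"])
      (auto simp: A_def C_def P_def h_def n_def delete_nth_delete_nth add.commute)
  finally show ?thesis by (simp add: sum_negf n_def)
qed

section \<open>Boundary coefficients as permutation signs\<close>

lemma boundary_coeff_delete_nth:
  "boundary_coeff zs ys = (\<Sum>j<length ys. (- 1) ^ j * simplex_coeff zs (delete_nth j ys))"
  by (simp add: boundary_coeff_def delete_nth_def)

text \<open>Only the deletion of \<open>v\<close> contributes, and its factor, -1 to the power of
  the position of \<open>v\<close>, is the sign of moving \<open>v\<close> to the front. This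
  replaces the alternating sum by a single sign.\<close>

lemma boundary_coeff_facet:
  assumes "distinct ys" "distinct (v # zs)" "set ys = set (v # zs)"
  shows "boundary_coeff zs ys = simplex_coeff (v # zs) ys"
proof -
  have "v \<in> set ys" using assms by simp
  then obtain us vs where ys: "ys = us @ v # vs" by (meson split_list)
  have j: "length us < length ys" "ys ! length us = v" using ys by auto
  have del: "delete_nth (length us) ys = us @ vs" by (simp add: ys delete_nth_def)
  \<comment> \<open>Any other deletion leaves \<open>v\<close> in the list, but \<open>v\<close> is
    not a vertex of \<open>zs\<close>.\<close>
  have "simplex_coeff zs (delete_nth i ys) = 0" if "i < length ys" "i \<noteq> length us" for i
  proof -
    have "ys ! i \<noteq> v"
      using that assms(1) j nth_eq_iff_index_eq by metis
    then have "v \<in> set (delete_nth i ys)"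
      using that assms(1) \<open>v \<in> set ys\<close> by (simp add: set_delete_nth)
    then have "set (delete_nth i ys) \<noteq> set zs" using assms(2) by auto
    then show ?thesis by (simp add: simplex_coeff_def)
  qed
  then have "boundary_coeff zs ys
      = (\<Sum>i<length ys. if i = length us then (- 1) ^ i * simplex_coeff zs (us @ vs) else 0)"
    unfolding boundary_coeff_delete_nth by (intro sum.cong) (auto simp: del)
  also have "\<dots> = simplex_coeff zs (us @ vs) * (- 1) ^ length us"
    using j by simp
  also have "\<dots> = simplex_coeff (v # zs) (v # us @ vs) * simplex_coeff (v # us @ vs) ys"
    using assms ys simplex_coeff_move_to_front[of us v vs] simplex_coeff_Cons[of v "us @ vs" zs]
    by auto
  also have "\<dots> = simplex_coeff (v # zs) ys"
    using assms ys by (intro simplex_coeff_trans) auto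
  finally show ?thesis .
qed

lemma boundary_coeff_not_facet:
  assumes "distinct ys" "\<And>v. v \<in> set ys \<Longrightarrow> set zs \<noteq> set ys - {v}"
  shows "boundary_coeff zs ys = 0"
  unfolding boundary_coeff_delete_nth
proof (rule sum.neutral, rule ballI)
  fix j assume "j \<in> {..<length ys}"
  then have "set (delete_nth j ys) \<noteq> set zs"
    using assms by (metis lessThan_iff nth_mem set_delete_nth)
  then show "(- 1) ^ j * simplex_coeff zs (delete_nth j ys) = 0"
    by (simp add: simplex_coeff_def)
qed

text \<open>The boundary is well defined on oriented simplices: reordering the vertices multiplies
  it by the sign of the reordering. For a facet this is transitivity of signs; otherwise both
  coefficients are zero.\<close>

lemma boundary_coeff_reorder:
  assumes "distinct zs" "distinct ys" "distinct ys'" "set ys = set ys'"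
  shows "boundary_coeff zs ys' * simplex_coeff ys' ys = boundary_coeff zs ys"
proof (cases "\<exists>v\<in>set ys. set zs = set ys - {v}")
  case True
  then obtain v where v: "v \<in> set ys" "set zs = set ys - {v}" by blast
  then have "set ys = set (v # zs)" "distinct (v # zs)" using assms by auto
  then show ?thesis
    using assms by (simp add: boundary_coeff_facet[where v = v] simplex_coeff_trans)
next
  case False
  then have "boundary_coeff zs ys = 0" "boundary_coeff zs ys' = 0"
    using assms by (auto intro!: boundary_coeff_not_facet)
  then show ?thesis by simp
qed

text \<open>The chosen ordering of an intermediate face occurs in both factors, so its sign cancels
  and the face may be ordered as it is inherited from \<open>xs\<close>. What remains is the
  alternating sum over double deletions.\<close>

lemma boundary_coeff_boundary_coeff:
  assumes xs: "distinct xs" and zs: "distinct zs" and "finite T"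
    and ori: "\<And>\<tau>. \<tau> \<in> T \<Longrightarrow> distinct (ori \<tau>) \<and> set (ori \<tau>) = \<tau>"
    and facets: "\<And>v. v \<in> set xs \<Longrightarrow> set xs - {v} \<in> T"
  shows "(\<Sum>\<tau>\<in>T. boundary_coeff zs (ori \<tau>) * boundary_coeff (ori \<tau>) xs) = 0"
proof -
  have inner: "(\<Sum>\<tau>\<in>T. boundary_coeff zs (ori \<tau>) * simplex_coeff (ori \<tau>) (delete_nth j xs))
      = boundary_coeff zs (delete_nth j xs)" if j: "j < length xs" for j
  proof -
    \<comment> \<open>For fixed \<open>j\<close> the face spanned by the shortened list is the only
      \<open>\<tau>\<close> with a nonzero summand.\<close>
    define \<rho> where "\<rho> = set (delete_nth j xs)"
    have "\<rho> \<in> T" using j xs facets by (simp add: \<rho>_def set_delete_nth)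
    have "boundary_coeff zs (ori \<tau>) * simplex_coeff (ori \<tau>) (delete_nth j xs)
        = (if \<tau> = \<rho> then boundary_coeff zs (delete_nth j xs) else 0)" if "\<tau> \<in> T" for \<tau>
    proof (cases "\<tau> = \<rho>")
      case True
      then show ?thesis
        using boundary_coeff_reorder[OF zs distinct_delete_nth[OF xs]] ori[OF that]
        by (auto simp: \<rho>_def)
    next
      case False
      then show ?thesis using ori[OF that] by (auto simp: \<rho>_def simplex_coeff_def)
    qed
    then show ?thesis using \<open>\<rho> \<in> T\<close> \<open>finite T\<close> by (simp add: sum.delta)
  qed
  have "(\<Sum>\<tau>\<in>T. boundary_coeff zs (ori \<tau>) * boundary_coeff (ori \<tau>) xs)
      = (\<Sum>\<tau>\<in>T. \<Sum>j<length xs.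
          (- 1) ^ j * (boundary_coeff zs (ori \<tau>) * simplex_coeff (ori \<tau>) (delete_nth j xs)))"
    by (simp add: boundary_coeff_delete_nth[of _ xs] sum_distrib_left ac_simps)
  also have "\<dots> = (\<Sum>j<length xs. \<Sum>\<tau>\<in>T.
          (- 1) ^ j * (boundary_coeff zs (ori \<tau>) * simplex_coeff (ori \<tau>) (delete_nth j xs)))"
    by (rule sum.swap)
  also have "\<dots> = (\<Sum>j<length xs. (- 1) ^ j * boundary_coeff zs (delete_nth j xs))"
    by (simp add: inner flip: sum_distrib_left)
  also have "\<dots> = (\<Sum>j<length xs. \<Sum>i<length xs - 1.
      (- 1) ^ (i + j) * simplex_coeff zs (delete_nth i (delete_nth j xs)))"
    by (simp add: boundary_coeff_delete_nth length_delete_nth sum_distrib_left power_add ac_simps)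
  also have "\<dots> = 0" by (rule sum_delete_nth_twice)
  finally show ?thesis .
qed

section \<open>Incidence matrices and the chain complex identity\<close>

lemma incidence_mat_carrier:
  "incidence_mat X ori enum k
    \<in> carrier_mat (num_simplices X (k - 1)) (num_simplices X k)"
  by (simp add: incidence_mat_def)

lemma incidence_mat_mult_incidence_mat:
  assumes X: "simplicial_complex X" and ori: "orientation X ori" and enum: "enumeration X enum"
    and k: "1 \<le> k"
  shows "incidence_mat X ori enum k * incidence_mat X ori enum (k + 1)
    = 0\<^sub>m (num_simplices X (k - 1)) (num_simplices X (k + 1))"
proof (rule eq_matI)
  fix i j
  assume "i < dim_row (0\<^sub>m (num_simplices X (k - 1)) (num_simplices X (k + 1)) :: real mat)"
    and "j < dim_col (0\<^sub>m (num_simplices X (k - 1)) (num_simplices X (k + 1)) :: real mat)"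
  then have i: "i < num_simplices X (k - 1)" and j: "j < num_simplices X (k + 1)" by simp_all
  have bij: "bij_betw (enum l) {..<num_simplices X l} (simplices X l)" for l
    using enum by (simp add: enumeration_def)
  have "enum (k - 1) i \<in> simplices X (k - 1)" using bij_betwE[OF bij] i by blast
  then have zs: "distinct (ori (enum (k - 1) i))"
    using ori by (auto simp: orientation_def simplices_def)
  have s: "enum (k + 1) j \<in> simplices X (k + 1)" using bij_betwE[OF bij] j by blast
  then have xs: "distinct (ori (enum (k + 1) j))" "set (ori (enum (k + 1) j)) = enum (k + 1) j"
    using ori by (auto simp: orientation_def simplices_def)
  have facets: "enum (k + 1) j - {v} \<in> simplices X k" if "v \<in> enum (k + 1) j" for v
  proof -
    have c: "card (enum (k + 1) j - {v}) = k + 1"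
      using s that X by (auto simp: simplices_def simplicial_complex_def)
    \<comment> \<open>A complex is closed only under nonempty subsets, so the facet must be shown
      nonempty.\<close>
    then have "card (enum (k + 1) j - {v}) \<noteq> 0" by simp
    then have "enum (k + 1) j - {v} \<noteq> {}" by (metis card.empty)
    moreover have "enum (k + 1) j \<in> X" using s by (simp add: simplices_def)
    ultimately have "enum (k + 1) j - {v} \<in> X"
      using X unfolding simplicial_complex_def by (meson Diff_subset)
    with c show ?thesis by (simp add: simplices_def)
  qed
  have "(incidence_mat X ori enum k * incidence_mat X ori enum (k + 1)) $$ (i, j)
      = (\<Sum>l<num_simplices X k. boundary_coeff (ori (enum (k - 1) i)) (ori (enum k l))
          * boundary_coeff (ori (enum k l)) (ori (enum (k + 1) j)))"
    using i j by (simp add: incidence_mat_def scalar_prod_def atLeast0LessThan)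
  \<comment> \<open>The enumeration turns the sum over matrix indices into a sum over all
    \<open>k\<close>-simplices, which include every facet of the column simplex.\<close>
  also have "\<dots> = (\<Sum>\<tau>\<in>simplices X k. boundary_coeff (ori (enum (k - 1) i)) (ori \<tau>)
          * boundary_coeff (ori \<tau>) (ori (enum (k + 1) j)))"
    by (rule sum.reindex_bij_betw[OF bij])
  also have "\<dots> = 0"
  proof (rule boundary_coeff_boundary_coeff[OF xs(1) zs])
    show "finite (simplices X k)" using X by (simp add: simplices_def simplicial_complex_def)
  qed (use ori xs facets in \<open>auto simp: orientation_def simplices_def\<close>)
  finally show "(incidence_mat X ori enum k * incidence_mat X ori enum (k + 1)) $$ (i, j)
    = 0\<^sub>m (num_simplices X (k - 1)) (num_simplices X (k + 1)) $$ (i, j)"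
    using i j by simp
qed (simp_all add: incidence_mat_def)

section \<open>Eigenvectors of a sum of mutually annihilating matrices\<close>

lemma eigenvectorD:
  assumes "A \<in> carrier_mat n n" "eigenvector A v a"
  shows "v \<in> carrier_vec n" "v \<noteq> 0\<^sub>v n" "A *\<^sub>v v = a \<cdot>\<^sub>v v"
  using assms by (auto simp: eigenvector_def)

lemma smult_vec_cancel:
  fixes v w :: "'a :: field vec"
  assumes "a \<noteq> 0" "a \<cdot>\<^sub>v v = a \<cdot>\<^sub>v w"
  shows "v = w"
proof -
  have "inverse a \<cdot>\<^sub>v (a \<cdot>\<^sub>v v) = inverse a \<cdot>\<^sub>v (a \<cdot>\<^sub>v w)" using assms by simp
  then show ?thesis using assms(1) by (simp add: smult_smult_assoc)
qed

lemma mult_mat_vec_mult_mat_vec_zero: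
  fixes A C :: "'a :: semiring_0 mat"
  assumes "A \<in> carrier_mat l m" "C \<in> carrier_mat m n" "A * C = 0\<^sub>m l n" "v \<in> carrier_vec n"
  shows "A *\<^sub>v (C *\<^sub>v v) = 0\<^sub>v l"
proof -
  have "A *\<^sub>v (C *\<^sub>v v) = 0\<^sub>m l n *\<^sub>v v"
    using assoc_mult_mat_vec[OF assms(1,2,4)] assms(3) by simp
  also have "\<dots> = 0\<^sub>v l"
    using assms(4) by (intro eq_vecI) auto
  finally show ?thesis .
qed

lemma mult_mat_vec_zero_vec:
  fixes A :: "'a :: semiring_0 mat"
  shows "A \<in> carrier_mat m n \<Longrightarrow> A *\<^sub>v 0\<^sub>v n = 0\<^sub>v m"
  by (intro eq_vecI) auto

text \<open>Since \<open>A\<close> kills the image of \<open>C\<close>, applying \<open>A\<close> to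
  the eigenvalue equation leaves only the \<open>A\<close> part: \<open>A *\<^sub>v v\<close> is
  zero or an eigenvector of \<open>A\<close> for \<open>a\<close>.\<close>

lemma annihilating_summand_component:
  fixes A C :: "'a :: field mat"
  assumes A: "A \<in> carrier_mat n n" and C: "C \<in> carrier_mat n n" and AC: "A * C = 0\<^sub>m n n"
    and v: "eigenvector (A + C) v a"
  shows "A *\<^sub>v (A *\<^sub>v v) = a \<cdot>\<^sub>v (A *\<^sub>v v)"
proof -
  have AC': "A + C \<in> carrier_mat n n" using A C by simp
  note v' = eigenvectorD[OF AC' v]
  have "A *\<^sub>v (C *\<^sub>v v) = 0\<^sub>v n"
    using A C AC v'(1) by (rule mult_mat_vec_mult_mat_vec_zero)
  then have "A *\<^sub>v (A *\<^sub>v v) = A *\<^sub>v (A *\<^sub>v v) + A *\<^sub>v (C *\<^sub>v v)"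
    using A v' by simp
  also have "\<dots> = A *\<^sub>v ((A + C) *\<^sub>v v)"
    using A C v'(1) by (simp add: mult_add_distrib_mat_vec add_mult_distrib_mat_vec)
  also have "\<dots> = a \<cdot>\<^sub>v (A *\<^sub>v v)"
    using A v' by (simp add: mult_mat_vec)
  finally show ?thesis .
qed

lemma eigenvector_add_annihilating:
  fixes A C :: "'a :: field mat"
  assumes A: "A \<in> carrier_mat n n" and C: "C \<in> carrier_mat n n"
    and AC: "A * C = 0\<^sub>m n n" and CA: "C * A = 0\<^sub>m n n"
    and a: "a \<noteq> 0" and v: "eigenvector (A + C) v a"
  shows "eigenvector A v a \<or> eigenvector C v a
    \<or> (\<exists>f g. v = f + g \<and> eigenvector A f a \<and> eigenvector C g a)"
proof -
  have AC': "A + C \<in> carrier_mat n n" using A C by simp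
  note v' = eigenvectorD[OF AC' v]
  \<comment> \<open>Dividing the two images of \<open>v\<close> by \<open>a\<close> makes them add
    up to \<open>v\<close> itself.\<close>
  define f where "f = inverse a \<cdot>\<^sub>v (A *\<^sub>v v)"
  define g where "g = inverse a \<cdot>\<^sub>v (C *\<^sub>v v)"
  have f: "f \<in> carrier_vec n" using mult_mat_vec_carrier[OF A v'(1)] by (simp add: f_def)
  have g: "g \<in> carrier_vec n" using mult_mat_vec_carrier[OF C v'(1)] by (simp add: g_def)
  have "f + g = inverse a \<cdot>\<^sub>v ((A + C) *\<^sub>v v)"
    unfolding f_def g_def using A C v'(1)
    by (simp add: smult_add_distrib_vec[of _ n] add_mult_distrib_mat_vec)
  then have fg: "v = f + g" using v' a by (simp add: smult_smult_assoc)
  have "A *\<^sub>v f = inverse a \<cdot>\<^sub>v (A *\<^sub>v (A *\<^sub>v v))"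
    using A v' by (simp add: f_def mult_mat_vec)
  then have Af: "A *\<^sub>v f = a \<cdot>\<^sub>v f"
    using annihilating_summand_component[OF A C AC v]
    by (simp add: f_def smult_smult_assoc mult.commute)
  have CA': "eigenvector (C + A) v a" using v A C by (simp add: comm_add_mat[of A n n C])
  have "C *\<^sub>v g = inverse a \<cdot>\<^sub>v (C *\<^sub>v (C *\<^sub>v v))"
    using C v' by (simp add: g_def mult_mat_vec)
  then have Cg: "C *\<^sub>v g = a \<cdot>\<^sub>v g"
    using annihilating_summand_component[OF C A CA CA']
    by (simp add: g_def smult_smult_assoc mult.commute)
  show ?thesis
  \<comment> \<open>If one component vanishes, \<open>v\<close> equals the other, which is nonzero
    because \<open>v\<close> is.\<close>
  proof (cases "f = 0\<^sub>v n \<or> g = 0\<^sub>v n")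
    case True
    then show ?thesis
      using fg f g A C v'(2) Af Cg by (auto simp: eigenvector_def)
  next
    case False
    then show ?thesis
      using fg f g A C Af Cg by (auto simp: eigenvector_def)
  qed
qed

lemma symmetric_mat_scalar_prod:
  fixes M :: "'a :: comm_semiring_0 mat"
  assumes "M \<in> carrier_mat n n" "transpose_mat M = M" "f \<in> carrier_vec n" "g \<in> carrier_vec n"
  shows "f \<bullet> (M *\<^sub>v g) = g \<bullet> (M *\<^sub>v f)"
  using transpose_vec_mult_scalar[of M n n g f] assms comm_scalar_prod[of "M *\<^sub>v f" n g]
  by simp

text \<open>Symmetry of \<open>W * A\<close> says that \<open>A\<close> is self-adjoint for the form
  given by \<open>W\<close>. Moving \<open>A\<close> from \<open>f\<close> to \<open>g\<close>
  yields zero, because \<open>g\<close> lies in the image of \<open>C\<close>, which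
  \<open>A\<close> kills.\<close>

lemma eigenvectors_orthogonal_annihilating:
  fixes A C W :: "'a :: field mat"
  assumes A: "A \<in> carrier_mat n n" and C: "C \<in> carrier_mat n n" and W: "W \<in> carrier_mat n n"
    and sym: "transpose_mat (W * A) = W * A" and AC: "A * C = 0\<^sub>m n n"
    and a: "a \<noteq> 0" "b \<noteq> 0" and f: "eigenvector A f a" and g: "eigenvector C g b"
  shows "g \<bullet> (W *\<^sub>v f) = 0"
proof -
  note f' = eigenvectorD[OF A f] and g' = eigenvectorD[OF C g]
  \<comment> \<open>Here \<open>b \<noteq> 0\<close> enters: it lets \<open>g\<close> be written as
    a multiple of \<open>C *\<^sub>v g\<close>. The condition \<open>a \<noteq> 0\<close> is used
    only in the last line.\<close>
  have "b \<cdot>\<^sub>v (A *\<^sub>v g) = A *\<^sub>v (C *\<^sub>v g)"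
    using A g' by (simp add: mult_mat_vec)
  also have "\<dots> = b \<cdot>\<^sub>v 0\<^sub>v n"
    using mult_mat_vec_mult_mat_vec_zero[OF A C AC g'(1)] by (auto simp: smult_vec_def)
  finally have Ag: "A *\<^sub>v g = 0\<^sub>v n" using smult_vec_cancel a by blast
  have "a * (g \<bullet> (W *\<^sub>v f)) = g \<bullet> (W * A *\<^sub>v f)"
    using A W f' g' by (simp add: mult_mat_vec assoc_mult_mat_vec[of W n n A n])
  also have "\<dots> = f \<bullet> (W * A *\<^sub>v g)"
    using sym A W f' g' by (intro symmetric_mat_scalar_prod[of _ n]) auto
  also have "\<dots> = 0"
    using A W f' g' Ag by (simp add: assoc_mult_mat_vec[of W n n A n] mult_mat_vec_zero_vec[OF W])
  finally show ?thesis using a by simp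
qed

section \<open>The Hodge Laplacians\<close>

lemma weight_mat_carrier: "weight_mat X enum w k \<in> carrier_mat (num_simplices X k) (num_simplices X k)"
  by (simp add: weight_mat_def)

lemma weight_mat_inv_carrier:
  "weight_mat_inv X enum w k \<in> carrier_mat (num_simplices X k) (num_simplices X k)"
  by (simp add: weight_mat_inv_def)

lemma transpose_mat_diag: "transpose_mat (mat_diag n f) = mat_diag n f"
  by (intro eq_matI) (auto simp: mat_diag_def)

lemma transpose_weight_mat: "transpose_mat (weight_mat X enum w k) = weight_mat X enum w k"
  by (simp add: weight_mat_def transpose_mat_diag)

lemma transpose_weight_mat_inv:
  "transpose_mat (weight_mat_inv X enum w k) = weight_mat_inv X enum w k"
  by (simp add: weight_mat_inv_def transpose_mat_diag)

lemma down_laplacian_carrier: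
  "down_laplacian X ori enum w k \<in> carrier_mat (num_simplices X k) (num_simplices X k)"
  by (rule carrier_matI)
    (simp_all add: down_laplacian_def incidence_mat_def weight_mat_def mat_diag_def)

lemma up_laplacian_carrier:
  "up_laplacian X ori enum w k \<in> carrier_mat (num_simplices X k) (num_simplices X k)"
  by (rule carrier_matI)
    (simp_all add: up_laplacian_def incidence_mat_def weight_mat_inv_def mat_diag_def)

text \<open>For \<open>k > 0\<close> the product has the Gram form \<open>(BW)^T V (BW)\<close> with
  \<open>V\<close> diagonal, hence is symmetric; for \<open>k = 0\<close> it is zero by
  convention.\<close>

lemma transpose_weight_mat_mult_down_laplacian:
  "transpose_mat (weight_mat X enum w k * down_laplacian X ori enum w k)
    = weight_mat X enum w k * down_laplacian X ori enum w k"
proof (cases "k = 0")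
  case True
  then show ?thesis
    using weight_mat_carrier[of X enum w 0] by (simp add: down_laplacian_def right_mult_zero_mat)
next
  case False
  define n m where "n = num_simplices X k" and "m = num_simplices X (k - 1)"
  define W V B where "W = weight_mat X enum w k" and "V = weight_mat_inv X enum w (k - 1)"
    and "B = incidence_mat X ori enum k"
  have W: "W \<in> carrier_mat n n" and V: "V \<in> carrier_mat m m" and B: "B \<in> carrier_mat m n"
    using weight_mat_carrier weight_mat_inv_carrier incidence_mat_carrier
    by (auto simp: n_def m_def W_def V_def B_def)
  have sym: "transpose_mat W = W" "transpose_mat V = V"
    by (simp_all add: W_def V_def transpose_weight_mat transpose_weight_mat_inv)
  have B': "transpose_mat B \<in> carrier_mat n m" using B by simp
  have BW: "B * W \<in> carrier_mat m n" using B W by simp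
  have "down_laplacian X ori enum w k = transpose_mat B * V * B * W"
    using False by (simp add: down_laplacian_def W_def V_def B_def)
  then have "W * down_laplacian X ori enum w k = transpose_mat (B * W) * (V * (B * W))"
    using W V B B' BW sym
    by (simp add: transpose_mult[OF B W] assoc_mult_mat[of _ n m _ m _ n] assoc_mult_mat[of _ n m _ n _ n]
        assoc_mult_mat[of _ m m _ n _ n] assoc_mult_mat[of _ n n _ m _ n])
  moreover have "transpose_mat (transpose_mat (B * W) * (V * (B * W)))
      = transpose_mat (B * W) * (V * (B * W))"
  proof -
    have "transpose_mat (transpose_mat (B * W) * (V * (B * W)))
        = transpose_mat (V * (B * W)) * (B * W)"
      using V BW by (subst transpose_mult[of _ n m _ n]) auto
    also have "\<dots> = transpose_mat (B * W) * V * (B * W)"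
      using V BW sym by (subst transpose_mult[of _ m m _ n]) auto
    also have "\<dots> = transpose_mat (B * W) * (V * (B * W))"
      using V BW by (intro assoc_mult_mat[of _ n m _ m _ n]) auto
    finally show ?thesis .
  qed
  ultimately show ?thesis by (simp add: W_def)
qed

text \<open>In the product down times up, the weights of order \<open>k\<close> and their inverses
  meet and cancel, leaving two consecutive incidence matrices side by side. In the other order the
  transposed incidence matrices are already adjacent.\<close>

lemma down_laplacian_mult_up_laplacian:
  assumes "simplicial_complex X" "orientation X ori" "enumeration X enum"
    and w: "\<And>\<sigma>. \<sigma> \<in> X \<Longrightarrow> 0 < w \<sigma>"
  shows "down_laplacian X ori enum w k * up_laplacian X ori enum w k
      = 0\<^sub>m (num_simplices X k) (num_simplices X k)"
    and "up_laplacian X ori enum w k * down_laplacian X ori enum w k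
      = 0\<^sub>m (num_simplices X k) (num_simplices X k)"
proof -
  define n m l where "n = num_simplices X k" and "m = num_simplices X (k - 1)"
    and "l = num_simplices X (k + 1)"
  \<comment> \<open>\<open>W\<close> and \<open>V\<close> are mutually inverse, both of order
    \<open>k\<close>; \<open>W'\<close> and \<open>B'\<close> belong to order \<open>k + 1\<close>,
    and \<open>V'\<close> to order \<open>k - 1\<close>.\<close>
  define W V W' V' B B' where "W = weight_mat X enum w k" and "V = weight_mat_inv X enum w k"
    and "W' = weight_mat X enum w (k + 1)" and "V' = weight_mat_inv X enum w (k - 1)"
    and "B = incidence_mat X ori enum k" and "B' = incidence_mat X ori enum (k + 1)"
  note defs = n_def m_def l_def W_def V_def W'_def V'_def B_def B'_def
  have c: "W \<in> carrier_mat n n" "V \<in> carrier_mat n n" "W' \<in> carrier_mat l l"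
    "V' \<in> carrier_mat m m" "B \<in> carrier_mat m n" "B' \<in> carrier_mat n l"
    "transpose_mat B \<in> carrier_mat n m" "transpose_mat B' \<in> carrier_mat l n"
    unfolding defs
    using weight_mat_carrier weight_mat_inv_carrier incidence_mat_carrier[of X ori enum k]
      incidence_mat_carrier[of X ori enum "k + 1"] by auto
  have WV: "W * V = 1\<^sub>m n"
    unfolding defs using weight_mat_inverse[OF assms(3) w] by simp
  have Lu: "up_laplacian X ori enum w k = V * B' * W' * transpose_mat B'"
    by (simp add: up_laplacian_def defs)
  have "down_laplacian X ori enum w k * up_laplacian X ori enum w k = 0\<^sub>m n n
      \<and> up_laplacian X ori enum w k * down_laplacian X ori enum w k = 0\<^sub>m n n"
  proof (cases "k = 0")
    case True
    then have "down_laplacian X ori enum w k = 0\<^sub>m n n" by (simp add: down_laplacian_def n_def)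
    then show ?thesis
      using up_laplacian_carrier[of X ori enum w k]
      by (auto simp: left_mult_zero_mat right_mult_zero_mat simp flip: n_def)
  next
    case False
    then have Ld: "down_laplacian X ori enum w k = transpose_mat B * V' * B * W"
      by (simp add: down_laplacian_def defs)
    have BB: "B * B' = 0\<^sub>m m l"
      unfolding defs using incidence_mat_mult_incidence_mat[OF assms(1-3)] False by simp
    have "transpose_mat B' * transpose_mat B = transpose_mat (B * B')"
      using c by (simp add: transpose_mult[of B m n B' l])
    also have "\<dots> = 0\<^sub>m l m" by (simp add: BB)
    finally have BB': "transpose_mat B' * transpose_mat B = 0\<^sub>m l m" .
    \<comment> \<open>The outer factors are bundled so that reassociation exposes
      \<open>B * B'\<close> and its transpose.\<close>
    define P Q R S where "P = transpose_mat B * V'" and "Q = W' * transpose_mat B'"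
      and "R = V * B' * W'" and "S = V' * B * W"
    have c': "P \<in> carrier_mat n m" "Q \<in> carrier_mat l n" "R \<in> carrier_mat n l"
      "S \<in> carrier_mat m n" using c by (simp_all add: P_def Q_def R_def S_def)
    have "down_laplacian X ori enum w k = P * B * W" by (simp add: Ld P_def)
    moreover have "up_laplacian X ori enum w k = V * (B' * Q)"
      using c by (simp add: Lu Q_def assoc_mult_mat[of _ n n _ l _ l]
          assoc_mult_mat[of _ n n _ l _ n] assoc_mult_mat[of _ n l _ l _ n])
    ultimately have "down_laplacian X ori enum w k * up_laplacian X ori enum w k
        = P * B * W * (V * (B' * Q))" by simp
    also have "\<dots> = P * B * (W * (V * (B' * Q)))"
      using c c' by (intro assoc_mult_mat[of _ n n _ n _ n]) auto
    also have "W * (V * (B' * Q)) = W * V * (B' * Q)"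
      using c c' by (intro assoc_mult_mat[of _ n n _ n _ n, symmetric]) auto
    also have "\<dots> = B' * Q"
      using c c' by (simp add: WV)
    also have "P * B * (B' * Q) = P * (B * (B' * Q))"
      using c c' by (intro assoc_mult_mat[of _ n m _ n _ n]) auto
    also have "B * (B' * Q) = B * B' * Q"
      using c c' by (simp add: assoc_mult_mat[of _ m n _ l _ n])
    also have "P * (B * B' * Q) = 0\<^sub>m n n"
      using c c' by (simp add: BB)
    finally have DU: "down_laplacian X ori enum w k * up_laplacian X ori enum w k = 0\<^sub>m n n" .
    have "down_laplacian X ori enum w k = transpose_mat B * S"
      using c by (simp add: Ld S_def assoc_mult_mat[of _ n m _ m _ n]
          assoc_mult_mat[of _ n m _ n _ n] assoc_mult_mat[of _ m m _ n _ n])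
    then have "up_laplacian X ori enum w k * down_laplacian X ori enum w k
        = R * transpose_mat B' * (transpose_mat B * S)"
      by (simp add: Lu R_def)
    also have "\<dots> = R * (transpose_mat B' * (transpose_mat B * S))"
      using c c' by (simp add: assoc_mult_mat[of _ n l _ n _ n])
    also have "transpose_mat B' * (transpose_mat B * S)
        = transpose_mat B' * transpose_mat B * S"
      using c c' by (simp add: assoc_mult_mat[of _ l n _ m _ n])
    also have "R * \<dots> = 0\<^sub>m n n"
      using c c' by (simp add: BB')
    finally show ?thesis using DU by simp
  qed
  then show "down_laplacian X ori enum w k * up_laplacian X ori enum w k
      = 0\<^sub>m (num_simplices X k) (num_simplices X k)"
    and "up_laplacian X ori enum w k * down_laplacian X ori enum w k
      = 0\<^sub>m (num_simplices X k) (num_simplices X k)"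
    by (simp_all add: n_def)
qed

text \<open>The down Laplacian of order \<open>k\<close> and the up Laplacian of order
  \<open>k - 1\<close> are cyclic rotations of the same four factors, so the transposed incidence
  matrix intertwines them.\<close>

lemma down_laplacian_transpose_incidence_mat:
  assumes "1 \<le> k" and v: "eigenvector (up_laplacian X ori enum w (k - 1)) v a"
  defines "u \<equiv> transpose_mat (incidence_mat X ori enum k) *\<^sub>v v"
  shows "down_laplacian X ori enum w k *\<^sub>v u = a \<cdot>\<^sub>v u"
    and "a \<noteq> 0 \<Longrightarrow> eigenvector (down_laplacian X ori enum w k) u a"
proof -
  define n m where "n = num_simplices X k" and "m = num_simplices X (k - 1)"
  define W V B where "W = weight_mat X enum w k" and "V = weight_mat_inv X enum w (k - 1)"
    and "B = incidence_mat X ori enum k"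
  have W: "W \<in> carrier_mat n n" and V: "V \<in> carrier_mat m m" and B: "B \<in> carrier_mat m n"
    using weight_mat_carrier weight_mat_inv_carrier incidence_mat_carrier
    by (auto simp: n_def m_def W_def V_def B_def)
  have B': "transpose_mat B \<in> carrier_mat n m" using B by simp
  have Lu: "up_laplacian X ori enum w (k - 1) = V * B * W * transpose_mat B"
    using assms(1) by (simp add: up_laplacian_def W_def V_def B_def)
  have Ld: "down_laplacian X ori enum w k = transpose_mat B * V * B * W"
    using assms(1) by (simp add: down_laplacian_def W_def V_def B_def)
  note v' = eigenvectorD[OF up_laplacian_carrier v, folded m_def]
  have u: "u = transpose_mat B *\<^sub>v v" by (simp add: u_def B_def)
  have uc: "u \<in> carrier_vec n" using B' v' by (simp add: u)
  have "V *\<^sub>v (B *\<^sub>v (W *\<^sub>v u)) = V * B * W * transpose_mat B *\<^sub>v v"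
    using V B W B' v' by (simp add: u assoc_mult_mat_vec[of _ m n _ m]
        assoc_mult_mat_vec[of _ m n _ n] assoc_mult_mat_vec[of _ m m _ n])
  also have "\<dots> = a \<cdot>\<^sub>v v" using v'(3) unfolding Lu .
  finally have VBW: "V *\<^sub>v (B *\<^sub>v (W *\<^sub>v u)) = a \<cdot>\<^sub>v v" .
  have "down_laplacian X ori enum w k *\<^sub>v u = transpose_mat B *\<^sub>v (V *\<^sub>v (B *\<^sub>v (W *\<^sub>v u)))"
    using V B W B' uc by (simp add: Ld assoc_mult_mat_vec[of _ n n _ n]
        assoc_mult_mat_vec[of _ n m _ n] assoc_mult_mat_vec[of _ n m _ m])
  also have "\<dots> = a \<cdot>\<^sub>v u" using VBW B' v' by (simp add: u mult_mat_vec)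
  finally show eq: "down_laplacian X ori enum w k *\<^sub>v u = a \<cdot>\<^sub>v u" .
  assume a: "a \<noteq> 0"
  \<comment> \<open>\<open>a \<cdot>\<^sub>v v\<close> is recovered from \<open>u\<close> by a
    linear map, so \<open>u = 0\<close> would force \<open>v = 0\<close>.\<close>
  have "u \<noteq> 0\<^sub>v n"
  proof
    assume "u = 0\<^sub>v n"
    then have "a \<cdot>\<^sub>v v = 0\<^sub>v m"
      using VBW by (simp add: mult_mat_vec_zero_vec[OF V] mult_mat_vec_zero_vec[OF B]
          mult_mat_vec_zero_vec[OF W])
    also have "\<dots> = a \<cdot>\<^sub>v 0\<^sub>v m" by (intro eq_vecI) auto
    finally have "a \<cdot>\<^sub>v v = a \<cdot>\<^sub>v 0\<^sub>v m" .
    then show False using smult_vec_cancel[OF a] v'(2) by blast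
  qed
  then show "eigenvector (down_laplacian X ori enum w k) u a"
    using eq uc down_laplacian_carrier[of X ori enum w k] by (simp add: eigenvector_def n_def)
qed

text \<open>In the second claim the image of \<open>v\<close> can be zero when \<open>a = 0\<close>,
  so it is called an eigenvector only for \<open>a \<noteq> 0\<close>. If \<open>a\<close> is an
  eigenvalue of both the down and the up Laplacian, a sum of eigenvectors of each is an eigenvector
  of \<open>L k\<close> but of neither summand. The third claim is therefore stated away from common
  eigenvalues, and the decomposition \<open>v = f + g\<close> covers the general case.\<close>

theorem theorem4:
  fixes X :: "'a set set" and ori :: "'a set \<Rightarrow> 'a list"
    and enum :: "nat \<Rightarrow> nat \<Rightarrow> 'a set" and w :: "'a set \<Rightarrow> real" and K k :: nat
    and B L Ld Lu :: "nat \<Rightarrow> real mat"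
  assumes "simplicial_complex X" and "X \<noteq> {}" and "complex_dim X = K"
    and "orientation X ori" and "enumeration X enum"
    and "\<forall>\<sigma>\<in>X. 0 < w \<sigma>"
    and "B = incidence_mat X ori enum"
    and "Ld = down_laplacian X ori enum w"
    and "Lu = up_laplacian X ori enum w"
    and "L = hodge_laplacian X ori enum w"
    and "k \<le> K"
  shows
    "(\<forall>f g a b. a \<noteq> 0 \<and> b \<noteq> 0 \<and> eigenvector (Ld k) f a \<and> eigenvector (Lu k) g b \<longrightarrow>
        weight_inner X enum w k f g = 0 \<and> weight_inner X enum w k g f = 0) \<and>
     (1 \<le> k \<longrightarrow> (\<forall>v a. eigenvector (Lu (k - 1)) v a \<longrightarrow>
        Ld k *\<^sub>v (transpose_mat (B k) *\<^sub>v v) = a \<cdot>\<^sub>v (transpose_mat (B k) *\<^sub>v v) \<and>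
        (a \<noteq> 0 \<longrightarrow> eigenvector (Ld k) (transpose_mat (B k) *\<^sub>v v) a))) \<and>
     (\<forall>v a. a \<noteq> 0 \<and> eigenvector (L k) v a \<and> \<not> (eigenvalue (Ld k) a \<and> eigenvalue (Lu k) a) \<longrightarrow>
        (\<exists>b. eigenvector (Ld k) v b) \<or> (\<exists>b. eigenvector (Lu k) v b)) \<and>
     (\<forall>v a. a \<noteq> 0 \<and> eigenvector (L k) v a \<longrightarrow>
        eigenvector (Ld k) v a \<or> eigenvector (Lu k) v a \<or>
        (\<exists>f g. v = f + g \<and> eigenvector (Ld k) f a \<and> eigenvector (Lu k) g a)) \<and>
     (\<forall>a. a \<noteq> 0 \<and> eigenvalue (L k) a \<longrightarrow> eigenvalue (Ld k) a \<or> eigenvalue (Lu k) a)"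
proof (intro conjI allI impI)
  define n where "n = num_simplices X k"
  have w: "\<And>\<sigma>. \<sigma> \<in> X \<Longrightarrow> 0 < w \<sigma>" using assms(6) by blast
  have Ld: "Ld k \<in> carrier_mat n n" and Lu: "Lu k \<in> carrier_mat n n"
    unfolding assms n_def by (rule down_laplacian_carrier up_laplacian_carrier)+
  have L: "L k = Ld k + Lu k"
    unfolding assms hodge_laplacian_def
    by (rule comm_add_mat[OF up_laplacian_carrier down_laplacian_carrier])
  have du: "Ld k * Lu k = 0\<^sub>m n n" and ud: "Lu k * Ld k = 0\<^sub>m n n"
    using down_laplacian_mult_up_laplacian[OF assms(1,4,5) w] by (auto simp: assms n_def)
  \<comment> \<open>The common source of all claims about eigenvectors and eigenvalues of
    \<open>L k\<close>.\<close>
  have split: "eigenvector (Ld k) v a \<or> eigenvector (Lu k) v a \<or>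
      (\<exists>f g. v = f + g \<and> eigenvector (Ld k) f a \<and> eigenvector (Lu k) g a)"
    if "a \<noteq> 0 \<and> eigenvector (L k) v a" for v a
    using eigenvector_add_annihilating[OF Ld Lu du ud] that by (simp add: L)
  {
    fix f g a b
    assume *: "a \<noteq> 0 \<and> b \<noteq> 0 \<and> eigenvector (Ld k) f a \<and> eigenvector (Lu k) g b"
    have W: "weight_mat X enum w k \<in> carrier_mat n n"
      unfolding n_def by (rule weight_mat_carrier)
    show fg: "weight_inner X enum w k f g = 0"
      unfolding weight_inner_def
    proof (rule eigenvectors_orthogonal_annihilating[OF Ld Lu W _ du, of a b])
      show "transpose_mat (weight_mat X enum w k * Ld k) = weight_mat X enum w k * Ld k"
        unfolding assms(8) by (rule transpose_weight_mat_mult_down_laplacian)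
    qed (use * in auto)
    show "weight_inner X enum w k g f = 0"
    proof -
      have "f \<in> carrier_vec n" "g \<in> carrier_vec n"
        using * eigenvectorD(1)[OF Ld, of f a] eigenvectorD(1)[OF Lu, of g b] by blast+
      then have "weight_inner X enum w k g f = weight_inner X enum w k f g"
        unfolding weight_inner_def
        by (rule symmetric_mat_scalar_prod[OF W transpose_weight_mat])
      then show ?thesis using fg by simp
    qed
  next
    fix v a
    assume "1 \<le> k" "eigenvector (Lu (k - 1)) v a"
    note * = down_laplacian_transpose_incidence_mat[OF this[unfolded assms(9)]]
    show "Ld k *\<^sub>v (transpose_mat (B k) *\<^sub>v v) = a \<cdot>\<^sub>v (transpose_mat (B k) *\<^sub>v v)"
      unfolding assms(7,8) by (rule *(1))
    show "eigenvector (Ld k) (transpose_mat (B k) *\<^sub>v v) a" if "a \<noteq> 0"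
      unfolding assms(7,8) using that by (rule *(2))
  next
    fix v a
    assume *: "a \<noteq> 0 \<and> eigenvector (L k) v a \<and> \<not> (eigenvalue (Ld k) a \<and> eigenvalue (Lu k) a)"
    then have "a \<noteq> 0 \<and> eigenvector (L k) v a" by simp
    \<comment> \<open>The mixed alternative would make \<open>a\<close> an eigenvalue of both
      Laplacians, which is excluded here.\<close>
    from split[OF this] * show "(\<exists>b. eigenvector (Ld k) v b) \<or> (\<exists>b. eigenvector (Lu k) v b)"
      unfolding eigenvalue_def by auto
  next
    fix v a
    assume "a \<noteq> 0 \<and> eigenvector (L k) v a"
    then show "eigenvector (Ld k) v a \<or> eigenvector (Lu k) v a \<or>
        (\<exists>f g. v = f + g \<and> eigenvector (Ld k) f a \<and> eigenvector (Lu k) g a)"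
      by (rule split)
  next
    fix a
    assume "a \<noteq> 0 \<and> eigenvalue (L k) a"
    then obtain v where "a \<noteq> 0 \<and> eigenvector (L k) v a" unfolding eigenvalue_def by blast
    from split[OF this] show "eigenvalue (Ld k) a \<or> eigenvalue (Lu k) a"
      unfolding eigenvalue_def by auto
  }
qed

end
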